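(* Let $m,n\geq 1$ and let $C\subseteq\mathfrak{S}_n^{(m)}$ be a metasylvester class, i.e. an equivalence class of the metasylvester congruence. Then $C$ is an interval of the $m$-permutations lattice.
   Context: An $m$-permutation of size $n$ is a rearrangement of the word $1^m2^m\cdots n^m$; their set is $\mathfrak{S}_n^{(m)}$. For a letter $b$, $b_i$ denotes the $i$-th occurrence of $b$ from the left. A co-inversion of $\sigma\in\mathfrak{S}_n^{(m)}$ is a pair $(a_i,b_j)$ with $1\leq a<b\leq n$, $1\le i,j\le m$, such that $b_j$ appears before $a_i$ in $\sigma$; $\mathrm{coinv}(\sigma)$ is the set of co-inversions, and $\sigma\leq\mu$ means $\mathrm{coinv}(\sigma)\subseteq\mathrm{coinv}(\mu)$ (the $m$-permutations lattice). The metasylvester congruence $\equiv$ on $\mathfrak{S}_n^{(m)}$ is the equivalence relation generated by $u\,ac\,v\,a\,w\equiv u\,ca\,v\,a\,w$ for letters $a<c$ and words $u,v,w$, and $u\,b\,v\,ac\,w\,b\,x\equiv u\,b\,v\,ca\,w\,b\,x$ for letters $a<b<c$ and words $u,v,w,x$. An interval of a poset is a subset of the form $\{z : x\leq z\leq y\}$ for some elements $x\leq y$. *)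

theory Defs
  imports "HOL-Library.Multiset"
begin

text \<open>Words are lists of natural numbers, with letters in \<open>{1..n}\<close>.\<close>

definition m_permutations :: "nat \<Rightarrow> nat \<Rightarrow> nat list set" where
  "m_permutations m n =
     {\<sigma>. mset \<sigma> = mset (concat (map (\<lambda>b. replicate m b) [1..<Suc n]))}"

text \<open>\<open>occurs_at \<sigma> b i p\<close>: the \<open>i\<close>-th occurrence (counted from 1, from the left) of the letter
  \<open>b\<close> in \<open>\<sigma>\<close> is at the 0-based position \<open>p\<close>.\<close>

definition occurs_at :: "nat list \<Rightarrow> nat \<Rightarrow> nat \<Rightarrow> nat \<Rightarrow> bool" where
  "occurs_at \<sigma> b i p \<longleftrightarrow>
     p < length \<sigma> \<and> \<sigma> ! p = b \<and> count_list (take (Suc p) \<sigma>) b = i"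

text \<open>The pair \<open>((a, i), (b, j))\<close> encodes \<open>(a\<^sub>i, b\<^sub>j)\<close>.\<close>

definition coinv :: "nat \<Rightarrow> nat \<Rightarrow> nat list \<Rightarrow> ((nat \<times> nat) \<times> (nat \<times> nat)) set" where
  "coinv m n \<sigma> =
     {((a, i), (b, j)) | a i b j.
        1 \<le> a \<and> a < b \<and> b \<le> n \<and> 1 \<le> i \<and> i \<le> m \<and> 1 \<le> j \<and> j \<le> m \<and>
        (\<exists>p q. occurs_at \<sigma> a i p \<and> occurs_at \<sigma> b j q \<and> q < p)}"

definition mperm_le :: "nat \<Rightarrow> nat \<Rightarrow> nat list \<Rightarrow> nat list \<Rightarrow> bool" where
  "mperm_le m n \<sigma> \<mu> \<longleftrightarrow> coinv m n \<sigma> \<subseteq> coinv m n \<mu>"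

inductive metasylvester_step :: "nat list \<Rightarrow> nat list \<Rightarrow> bool" where
  aca: "a < c \<Longrightarrow>
    metasylvester_step (u @ [a, c] @ v @ [a] @ w) (u @ [c, a] @ v @ [a] @ w)"
| bacb: "a < b \<Longrightarrow> b < c \<Longrightarrow>
    metasylvester_step (u @ [b] @ v @ [a, c] @ w @ [b] @ x) (u @ [b] @ v @ [c, a] @ w @ [b] @ x)"

definition metasylvester :: "nat \<Rightarrow> nat \<Rightarrow> (nat list \<times> nat list) set" where
  "metasylvester m n =
     {(\<sigma>, \<mu>) \<in> m_permutations m n \<times> m_permutations m n.
        equivclp (\<lambda>\<alpha> \<beta>. \<alpha> \<in> m_permutations m n \<and> \<beta> \<in> m_permutations m n \<and>
                        metasylvester_step \<alpha> \<beta>) \<sigma> \<mu>}"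

definition poset_interval :: "'a set \<Rightarrow> ('a \<Rightarrow> 'a \<Rightarrow> bool) \<Rightarrow> 'a set \<Rightarrow> bool" where
  "poset_interval P le I \<longleftrightarrow> (\<exists>x\<in>P. \<exists>y\<in>P. le x y \<and> I = {z \<in> P. le x z \<and> le z y})"

end

(* The proof follows the pattern of lattice congruences of the weak order. An ascent a c of a word
   can be switched within its class exactly when some letter b with a \<le> b < c occurs both weakly
   before and after that a; call such a switch contractible. Two ascents of a word span a square or
   a hexagon in the lattice. Opposite edges of these polygons are simultaneously contractible, and
   contractibility of the lower edge on the two smallest letters forces that of the two middle
   edges of the hexagon. Hence contractible switches are confluent upwards and downwards, and every
   class has a greatest word y and a least word x. If s reaches y by contractible switches, then by
   the same polygons so does every cover of s below y; climbing from x to any word z of the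
   interval, all switches are contractible, so z lies in the class. *)

theory Submission
  imports Defs "HOL-Library.Confluence"
begin

section \<open>Terminating locally confluent relations\<close>

text \<open>Newman's lemma: a terminating, locally confluent relation is confluent, so the elements
  of an equivalence class share one normal form, here the normal form of \<open>x\<close>. It is
  stated for any \<open>R\<close> because it serves both the upward and the downward
  direction.\<close>

lemma newman_equivclp:
  fixes R :: "'a \<Rightarrow> 'a \<Rightarrow> bool"
  assumes wf: "wfp (R\<inverse>\<inverse>)"
    and local_confl: "\<And>s t t'. R s t \<Longrightarrow> R s t' \<Longrightarrow> \<exists>r. R\<^sup>*\<^sup>* t r \<and> R\<^sup>*\<^sup>* t' r"
  shows "\<exists>y. \<forall>z. equivclp R x z \<longrightarrow> R\<^sup>*\<^sup>* z y"
proof -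
  have confl: "\<exists>r. R\<^sup>*\<^sup>* t r \<and> R\<^sup>*\<^sup>* t' r" if "R\<^sup>*\<^sup>* s t" "R\<^sup>*\<^sup>* s t'" for s t t'
    using wf that
  proof (induction s arbitrary: t t' rule: wfp_induct_rule)
    case (less s)
    show ?case
    proof (cases "s = t \<or> s = t'")
      case True
      then show ?thesis using less.prems by blast
    next
      case False
      obtain s1 s2 where s1: "R s s1" "R\<^sup>*\<^sup>* s1 t" and s2: "R s s2" "R\<^sup>*\<^sup>* s2 t'"
        using less.prems False by (metis converse_rtranclpE)
      obtain r where r: "R\<^sup>*\<^sup>* s1 r" "R\<^sup>*\<^sup>* s2 r" using local_confl s1(1) s2(1) by blast
      obtain p where p: "R\<^sup>*\<^sup>* t p" "R\<^sup>*\<^sup>* r p" using less.IH[of s1 t r] s1 r by auto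
      have "R\<^sup>*\<^sup>* s2 p" using r(2) p(2) by simp
      then obtain q where "R\<^sup>*\<^sup>* p q" "R\<^sup>*\<^sup>* t' q" using less.IH[of s2 p t'] s2 by auto
      then show ?thesis using p(1) by (meson rtranclp_trans)
    qed
  qed
  \<comment> \<open>Church-Rosser property: equivalent elements have a common reduct. The only
    reduct of the irreducible \<open>y\<close> is \<open>y\<close> itself.\<close>
  have eq: "equivclp R = R\<^sup>*\<^sup>* OO R\<inverse>\<inverse>\<^sup>*\<^sup>*"
    by (rule semiconfluentp_equivclp) (blast intro: semiconfluentpI confl)
  have nf: "\<exists>y. R\<^sup>*\<^sup>* s y \<and> (\<forall>z. \<not> R y z)" for s
    using wf
  proof (induction s rule: wfp_induct_rule)
    case (less s)
    then show ?case
      by (metis conversepI converse_rtranclp_into_rtranclp rtranclp.rtrancl_refl)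
  qed
  obtain y where y: "R\<^sup>*\<^sup>* x y" "\<And>z. \<not> R y z" using nf by blast
  have "R\<^sup>*\<^sup>* z y" if "equivclp R x z" for z
  proof -
    have "equivclp R z y"
      using that y(1) by (meson equivclp_sym equivclp_trans predicate2D rtranlcp_le_equivclp)
    then obtain r where "R\<^sup>*\<^sup>* z r" "R\<^sup>*\<^sup>* y r" unfolding eq by (auto simp: rtranclp_conversep)
    then show ?thesis using y(2) by (metis converse_rtranclpE)
  qed
  then show ?thesis by blast
qed

section \<open>Co-inversions and adjacent transpositions\<close>

lemma count_list_m_permutation:
  assumes "s \<in> m_permutations m n"
  shows "count_list s b = (if 1 \<le> b \<and> b \<le> n then m else 0)"
proof -
  have "count_list (concat (map (replicate m) xs)) b = (if b \<in> set xs then m else 0)"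
    if "distinct xs" for xs
  proof -
    have "count_list (replicate m a) b = (if a = b then m else 0)" for a
      by (induction m) auto
    with that show ?thesis by (induction xs) auto
  qed
  from this[of "[1..<Suc n]"] show ?thesis
    using assms unfolding m_permutations_def
    by (auto simp flip: count_mset)
qed

lemma m_permutations_cong: "mset s = mset t \<Longrightarrow> s \<in> m_permutations m n \<longleftrightarrow> t \<in> m_permutations m n"
  unfolding m_permutations_def by (simp only: mem_Collect_eq)

lemma m_permutations_swap:
  "u @ c # a # v \<in> m_permutations m n \<longleftrightarrow> u @ a # c # v \<in> m_permutations m n"
  by (rule m_permutations_cong) simp

text \<open>Positions are traded for a cut of the word: b_j precedes a_i iff some prefix already
  holds j letters b but fewer than i letters a. A cut directly before a_i is such a prefix; the
  bound on \<open>count_list s a\<close> says that a_i exists.\<close>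

lemma coinv_iff_prefix:
  "((a, i), (b, j)) \<in> coinv m n s \<longleftrightarrow>
     1 \<le> a \<and> a < b \<and> b \<le> n \<and> 1 \<le> i \<and> i \<le> m \<and> 1 \<le> j \<and> j \<le> m \<and>
     i \<le> count_list s a \<and> (\<exists>u v. s = u @ v \<and> j \<le> count_list u b \<and> count_list u a < i)"
proof -
  have mono: "count_list (take k s) b \<le> count_list (take l s) b" if "k \<le> l" for k l b
    using that by (metis count_list_append le_add1 le_add_diff_inverse take_add)
  \<comment> \<open>Discrete intermediate value: prefix counts grow by at most one, so a count that
    rises from below i to at least i does so at the i-th occurrence.\<close>
  have occ: "\<exists>p. occurs_at s b i p \<and> k \<le> p \<and> p < l"
    if "count_list (take k s) b < i" "i \<le> count_list (take l s) b" for b i k l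
    using that
  proof (induction l)
    case (Suc l)
    show ?case
    proof (cases "i \<le> count_list (take l s) b")
      case True
      then show ?thesis using Suc by fastforce
    next
      case False
      then have l: "l < length s" using Suc.prems by (cases "l < length s") auto
      then have "occurs_at s b i l" using Suc.prems False
        by (auto simp: occurs_at_def take_Suc_conv_app_nth split: if_splits)
      moreover have "k \<le> l"
      proof (rule ccontr)
        assume "\<not> k \<le> l"
        then have "count_list (take (Suc l) s) b \<le> count_list (take k s) b" by (intro mono) simp
        then show False using Suc.prems by simp
      qed
      ultimately show ?thesis by blast
    qed
  qed simp
  have "(\<exists>p q. occurs_at s a i p \<and> occurs_at s b j q \<and> q < p) \<longleftrightarrow>
      i \<le> count_list s a \<and> (\<exists>u v. s = u @ v \<and> j \<le> count_list u b \<and> count_list u a < i)"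
    if j: "1 \<le> j"
  proof (intro iffI conjI; elim exE conjE)
    fix p q assume pq: "occurs_at s a i p" "occurs_at s b j q" "q < p"
    show "i \<le> count_list s a"
      using pq(1) mono[of "Suc p" "length s" a] by (auto simp: occurs_at_def)
    have "count_list (take p s) a < i"
      using pq(1) by (auto simp: occurs_at_def take_Suc_conv_app_nth)
    moreover have "j \<le> count_list (take p s) b"
      using pq(2,3) mono[of "Suc q" p b] by (auto simp: occurs_at_def)
    ultimately show "\<exists>u v. s = u @ v \<and> j \<le> count_list u b \<and> count_list u a < i"
      by (metis append_take_drop_id)
  next
    fix u v assume *: "i \<le> count_list s a" "s = u @ v" "j \<le> count_list u b" "count_list u a < i"
    obtain q where "occurs_at s b j q" "q < length u"
      using occ[of 0 b j "length u"] * j by auto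
    moreover obtain p where "occurs_at s a i p" "length u \<le> p"
      using occ[of "length u" a i "length s"] * by auto
    ultimately show "\<exists>p q. occurs_at s a i p \<and> occurs_at s b j q \<and> q < p"
      by (meson order_less_le_trans)
  qed
  then show ?thesis unfolding coinv_def by auto
qed

lemma coinv_iff:
  assumes "s \<in> m_permutations m n"
  shows "((a, i), (b, j)) \<in> coinv m n s \<longleftrightarrow>
     1 \<le> a \<and> a < b \<and> b \<le> n \<and> 1 \<le> i \<and> i \<le> m \<and> 1 \<le> j \<and> j \<le> m \<and>
     (\<exists>u v. s = u @ v \<and> j \<le> count_list u b \<and> count_list u a < i)"
proof -
  have "i \<le> count_list s a" if "1 \<le> a" "a < b" "b \<le> n" "i \<le> m"
    using count_list_m_permutation[OF assms, of a] that by simp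
  then show ?thesis unfolding coinv_iff_prefix by blast
qed

text \<open>The bounds by \<open>m\<close> and \<open>n\<close> come for free: a letter that occurs
  lies between 1 and n, and its occurrence indices are at most m.\<close>

lemma coinvI:
  assumes "u @ v \<in> m_permutations m n" "a < b" "1 \<le> j" "j \<le> count_list u b"
    "count_list u a < i" "i \<le> count_list (u @ v) a"
  shows "((a, i), (b, j)) \<in> coinv m n (u @ v)"
  using assms count_list_m_permutation[OF assms(1), of a] count_list_m_permutation[OF assms(1), of b]
  unfolding coinv_iff_prefix by (fastforce split: if_splits)

lemma coinv_subset: "coinv m n s \<subseteq> ({0..n} \<times> {0..m}) \<times> ({0..n} \<times> {0..m})"
  by (auto simp: coinv_def)

lemma finite_coinv: "finite (coinv m n s)"
  by (rule finite_subset[OF coinv_subset]) auto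

lemma coinv_trans:
  assumes "s \<in> m_permutations m n"
    and "((a, i), (b, j)) \<in> coinv m n s" "((b, j), (c, k)) \<in> coinv m n s"
  shows "((a, i), (c, k)) \<in> coinv m n s"
proof -
  obtain u v u' v' where *: "s = u @ v" "j \<le> count_list u b" "count_list u a < i"
    "s = u' @ v'" "k \<le> count_list u' c" "count_list u' b < j"
    using assms unfolding coinv_iff[OF assms(1)] by blast
  \<comment> \<open>The prefix \<open>u'\<close> holds fewer letters b than \<open>u\<close>, so it
    is the shorter of the two.\<close>
  then obtain w where "u = u' @ w" by (auto simp: append_eq_append_conv2)
  then have "count_list u' a < i" using * by simp
  then show ?thesis
    using assms(2,3) *(4,5) unfolding coinv_iff[OF assms(1)] by (metis order_less_trans)
qed

text \<open>The next occurrences of \<open>a\<close> and \<open>c\<close> after the prefix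
  \<open>u\<close>, hence the successors. Switching an ascent directly after \<open>u\<close>
  creates exactly this co-inversion.\<close>

abbreviation swap_pair :: "nat list \<Rightarrow> nat \<Rightarrow> nat \<Rightarrow> (nat \<times> nat) \<times> (nat \<times> nat)" where
  "swap_pair u a c \<equiv> ((a, Suc (count_list u a)), (c, Suc (count_list u c)))"

lemma prefix_cases:
  assumes "w @ w' = u @ a # c # v"
  shows "(\<exists>t. u = w @ t) \<or> w = u @ [a] \<or> (\<exists>t. w = u @ a # c # t \<and> v = t @ w')"
proof -
  from assms consider t where "w = u @ t" "t @ w' = a # c # v" | t where "u = w @ t"
    unfolding append_eq_append_conv2 by metis
  then show ?thesis
  proof cases
    case 1
    then show ?thesis by (cases t; cases "tl t") auto
  qed blast
qed

text \<open>Switching an ascent is an upward step adding a single co-inversion: cuts before or after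
  the two letters give the same counts in both words, and only the cut between them changes.\<close>

lemma coinv_swap:
  assumes s: "u @ a # c # v \<in> m_permutations m n" and "a < c"
  shows "coinv m n (u @ c # a # v) = insert (swap_pair u a c) (coinv m n (u @ a # c # v))"
    and "swap_pair u a c \<notin> coinv m n (u @ a # c # v)"
proof -
  let ?s = "u @ a # c # v" and ?t = "u @ c # a # v"
  have t: "?t \<in> m_permutations m n" using s by (simp add: m_permutations_swap)
  show "swap_pair u a c \<notin> coinv m n ?s"
  proof
    assume "swap_pair u a c \<in> coinv m n ?s"
    then obtain w w' where w: "?s = w @ w'" "Suc (count_list u c) \<le> count_list w c"
      "count_list w a < Suc (count_list u a)"
      unfolding coinv_iff[OF s] by blast
    show False using prefix_cases[OF w(1)[symmetric]] w(2,3) \<open>a < c\<close> by auto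
  qed
  have "x \<in> coinv m n ?t \<longleftrightarrow> x = swap_pair u a c \<or> x \<in> coinv m n ?s" for x
  proof -
    obtain a' i b j where x: "x = ((a', i), (b, j))" by (metis surj_pair)
    have "x = swap_pair u a c \<or> x \<in> coinv m n ?s" if xin: "x \<in> coinv m n ?t"
    proof -
      obtain w w' where w: "?t = w @ w'" "j \<le> count_list w b" "count_list w a' < i" and "a' < b"
        using xin unfolding x coinv_iff[OF t] by blast
      have I: "x \<in> coinv m n ?s"
        if "?s = p @ q" "j \<le> count_list p b" "count_list p a' < i" for p q
        using xin that unfolding x coinv_iff[OF t] coinv_iff[OF s] by blast
      show ?thesis using prefix_cases[OF w(1)[symmetric]]
      proof (elim disjE exE conjE)
        fix r assume "u = w @ r"
        then show ?thesis using w I[of w "r @ a # c # v"] by simp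
      next
        fix r assume r: "w = u @ c # a # r" "v = r @ w'"
        then show ?thesis using w I[of "u @ a # c # r" w'] by (auto split: if_splits)
      next
        assume wu: "w = u @ [c]"
        \<comment> \<open>The cut between \<open>c\<close> and \<open>a\<close> can be replaced by
          the one before both letters unless it needs the new c, and by the one after both unless it
          needs the absence of the new a. Only the new pair needs both.\<close>
        show ?thesis
        proof (rule ccontr)
          assume "\<not> ?thesis"
          then show False
            using w wu I[of u "a # c # v"] I[of "u @ [a, c]" v] \<open>a' < b\<close> \<open>a < c\<close>
            by (cases "a = a'") (auto simp: x split: if_splits)
        qed
      qed
    qed
    moreover have "x \<in> coinv m n ?t" if xin: "x \<in> coinv m n ?s"
    proof -
      obtain w w' where w: "?s = w @ w'" "j \<le> count_list w b" "count_list w a' < i" and "a' < b"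
        using xin unfolding x coinv_iff[OF s] by blast
      have I: "x \<in> coinv m n ?t"
        if "?t = p @ q" "j \<le> count_list p b" "count_list p a' < i" for p q
        using xin that unfolding x coinv_iff[OF t] coinv_iff[OF s] by blast
      show ?thesis using prefix_cases[OF w(1)[symmetric]]
      proof (elim disjE exE conjE)
        fix r assume "u = w @ r"
        then show ?thesis using w I[of w "r @ c # a # v"] by simp
      next
        fix r assume r: "w = u @ a # c # r" "v = r @ w'"
        then show ?thesis using w I[of "u @ c # a # r" w'] by (auto split: if_splits)
      next
        assume wu: "w = u @ [a]"
        show ?thesis
        proof (cases "b = a")
          case True
          then show ?thesis using w wu \<open>a' < b\<close> \<open>a < c\<close> I[of "u @ [c, a]" v] by (auto split: if_splits)
        next
          case False
          then show ?thesis using w wu I[of u "c # a # v"] by (auto split: if_splits)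
        qed
      qed
    qed
    moreover have "swap_pair u a c \<in> coinv m n ?t"
      using coinvI[of "u @ [c]" "a # v"] t \<open>a < c\<close> by simp
    ultimately show ?thesis by blast
  qed
  then show "coinv m n ?t = insert (swap_pair u a c) (coinv m n ?s)" by blast
qed

text \<open>If \<open>s = p x \<dots>\<close> and \<open>z = p y \<dots>\<close> first differ in \<open>x\<close> and \<open>y\<close>, the ascent ends in the next
  \<open>y\<close> of \<open>s\<close>: a larger letter before that \<open>y\<close> would give a co-inversion of \<open>s\<close> that \<open>z\<close> lacks.\<close>

lemma exists_ascent_below:
  assumes s: "s \<in> m_permutations m n" and z: "z \<in> m_permutations m n"
    and le: "coinv m n s \<subseteq> coinv m n z" and "s \<noteq> z"
  obtains u a c v where "s = u @ a # c # v" "a < c" "swap_pair u a c \<in> coinv m n z"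
proof -
  have ms: "mset s = mset z" using s z by (simp add: m_permutations_def)
  then have "length s = length z" by (rule mset_eq_length)
  then obtain p x s' y z' where "s = p @ [x] @ s'" "z = p @ [y] @ z'" and xy_neq: "x \<noteq> y"
    using same_length_different[OF \<open>s \<noteq> z\<close>] by blast
  then have xy: "s = p @ x # s'" "z = p @ y # z'" by simp_all
  have cnt: "count_list s b = count_list z b" for b
    using s z by (simp add: count_list_m_permutation)
  have "y \<in> set s'"
  proof -
    have "add_mset x (mset s') = add_mset y (mset z')" using ms xy by simp
    then have "y \<in># add_mset x (mset s')" by simp
    then show ?thesis using xy_neq by simp
  qed
  then obtain r t where rt: "s' = r @ y # t" "y \<notin> set r" by (meson split_list_first)
  have small: "d < y" if d: "d \<in> set (x # r)" for d
  proof (rule ccontr)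
    assume "\<not> d < y"
    then have "y < d" using d rt(2) xy_neq by (metis linorder_neqE_nat set_ConsD)
    obtain r1 r2 where r12: "x # r = r1 @ d # r2" "d \<notin> set r1" using d by (meson split_list_first)
    have s_eq: "s = p @ r1 @ d # r2 @ y # t" using xy(1) rt(1) r12(1) by simp
    have y1: "y \<notin> set (r1 @ d # r2)" using r12(1) rt(2) xy_neq by (metis set_ConsD)
    \<comment> \<open>The letter d follows \<open>p\<close> and precedes the next y of
      \<open>s\<close>. In \<open>z\<close> that y stands directly after \<open>p\<close>, so no
      prefix can gain a d before it.\<close>
    have "swap_pair p y d \<in> coinv m n s"
      using coinvI[of "p @ r1 @ [d]" "r2 @ y # t" m n y d] s \<open>y < d\<close> y1 r12(2) s_eq by simp
    then have "swap_pair p y d \<in> coinv m n z" using le by blast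
    then obtain w w' where w: "z = w @ w'" "Suc (count_list p d) \<le> count_list w d"
      "count_list w y < Suc (count_list p y)"
      unfolding coinv_iff[OF z] by blast
    then consider t where "p = w @ t" | t where "w = p @ t" "t @ w' = y # z'"
      using xy(2) by (metis append_eq_append_conv2)
    then show False
    proof cases
      case 1
      then show False using w(2) by simp
    next
      case 2
      then show False using w(2,3) by (cases t) auto
    qed
  qed
  define q a where "q = butlast (x # r)" and "a = last (x # r)"
  have qa: "x # r = q @ [a]" unfolding q_def a_def by simp
  have s_eq: "s = (p @ q) @ a # y # t" using xy(1) rt(1) qa by simp
  have "a < y" using small[of a] qa by simp
  have "y \<notin> set q" using small[of y] qa by auto
  \<comment> \<open>The cut of \<open>z\<close> after \<open>p @ [y]\<close> witnesses this: as
    \<open>q\<close> contains no y, the y of the pair is the one directly after \<open>p\<close>,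
    and no further a has been read by then.\<close>
  have "swap_pair (p @ q) a y \<in> coinv m n z"
  proof -
    have "Suc (count_list (p @ q) a) \<le> count_list z a"
      using s_eq cnt[of a] by simp
    then show ?thesis
      using coinvI[of "p @ [y]" z' m n a y] z \<open>a < y\<close> \<open>y \<notin> set q\<close> xy(2) by simp
  qed
  then show ?thesis using that s_eq \<open>a < y\<close> by blast
qed

section \<open>Contractible ascents\<close>

text \<open>Both generating rules at once. The first disjunct is the case b = a, where the switched
  a is itself the earlier occurrence and only a later one is required.\<close>

definition contractible :: "nat list \<Rightarrow> nat \<Rightarrow> nat \<Rightarrow> nat list \<Rightarrow> bool" where
  "contractible u a c v \<longleftrightarrow> a \<in> set v \<or> (\<exists>b. a < b \<and> b < c \<and> b \<in> set u \<and> b \<in> set v)"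

lemma metasylvester_step_iff:
  "metasylvester_step s t \<longleftrightarrow>
     (\<exists>u a c v. s = u @ a # c # v \<and> t = u @ c # a # v \<and> a < c \<and> contractible u a c v)"
proof
  assume "metasylvester_step s t"
  then show "\<exists>u a c v. s = u @ a # c # v \<and> t = u @ c # a # v \<and> a < c \<and> contractible u a c v"
  proof cases
    case (aca a c u v w)
    then show ?thesis
      by (intro exI[of _ u] exI[of _ a] exI[of _ c] exI[of _ "v @ a # w"])
        (auto simp: contractible_def)
  next
    case (bacb a b c u v w x)
    then show ?thesis
      by (intro exI[of _ "u @ b # v"] exI[of _ a] exI[of _ c] exI[of _ "w @ b # x"])
        (auto simp: contractible_def)
  qed
next
  assume "\<exists>u a c v. s = u @ a # c # v \<and> t = u @ c # a # v \<and> a < c \<and> contractible u a c v"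
  then obtain u a c v where *: "s = u @ a # c # v" "t = u @ c # a # v" "a < c"
    and "contractible u a c v" by blast
  then consider "a \<in> set v" | b where "a < b" "b < c" "b \<in> set u" "b \<in> set v"
    unfolding contractible_def by blast
  then show "metasylvester_step s t"
  proof cases
    case 1
    then obtain v1 v2 where "v = v1 @ a # v2" by (meson split_list)
    then show ?thesis using metasylvester_step.aca[of a c u v1 v2] * by simp
  next
    case 2
    obtain u1 u2 v1 v2 where "u = u1 @ b # u2" "v = v1 @ b # v2" using 2 by (meson split_list)
    then show ?thesis using metasylvester_step.bacb[of a b c u1 u2 v1 v2] * 2 by simp
  qed
qed

text \<open>The words first differ at the switched pair, so they determine its place. Hence
  contractibility can be read off any given decomposition of a step.\<close>

lemma swap_unique:
  assumes "u @ a # c # v = u' @ a' # c' # v'" "u @ c # a # v = u' @ c' # a' # v'" "a \<noteq> c" "a' \<noteq> c'"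
  shows "u = u' \<and> a = a' \<and> c = c' \<and> v = v'"
  using assms
proof (induction u arbitrary: u')
  case Nil
  then show ?case by (cases u') auto
next
  case (Cons x u)
  then show ?case by (cases u') auto
qed

lemma metasylvester_step_swap:
  assumes "a < c"
  shows "metasylvester_step (u @ a # c # v) (u @ c # a # v) \<longleftrightarrow> contractible u a c v"
proof
  assume "metasylvester_step (u @ a # c # v) (u @ c # a # v)"
  then obtain u' a' c' v' where "u @ a # c # v = u' @ a' # c' # v'"
    "u @ c # a # v = u' @ c' # a' # v'" "a' < c'" and contr: "contractible u' a' c' v'"
    unfolding metasylvester_step_iff by blast
  then show "contractible u a c v"
    using swap_unique[of u a c v u' a' c' v'] assms by simp
qed (use assms metasylvester_step_iff in blast)

text \<open>Two ascents, or two descents, of one word: an overlap leads to a hexagon, disjoint pairs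
  lead to a square.\<close>

lemma adjacent_pairs_cases:
  assumes "u @ a # c # v = u' @ a' # c' # v'" "length u \<le> length u'"
  obtains (same) "u' = u" "a' = a" "c' = c" "v' = v"
  | (overlap) "u' = u @ [a]" "a' = c" "v = c' # v'"
  | (disjoint) t where "u' = u @ a # c # t" "v = t @ a' # c' # v'"
proof -
  obtain t where "u' = u @ t" "a # c # v = t @ a' # c' # v'"
    using assms by (auto simp: append_eq_append_conv2)
  then show thesis by (cases t; cases "tl t") (auto intro: that)
qed

section \<open>Upward contractible switches and their termination\<close>

definition mstep :: "nat \<Rightarrow> nat \<Rightarrow> nat list \<Rightarrow> nat list \<Rightarrow> bool" where
  "mstep m n s t \<longleftrightarrow> s \<in> m_permutations m n \<and> t \<in> m_permutations m n \<and> metasylvester_step s t"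

lemma mstepE:
  assumes "mstep m n s t"
  obtains u a c v where "s = u @ a # c # v" "t = u @ c # a # v" "a < c" "contractible u a c v"
    "s \<in> m_permutations m n"
  using assms unfolding mstep_def metasylvester_step_iff by blast

lemma mstep_swap:
  "a < c \<Longrightarrow> mstep m n (u @ a # c # v) (u @ c # a # v) \<longleftrightarrow>
     u @ a # c # v \<in> m_permutations m n \<and> contractible u a c v"
  unfolding mstep_def by (metis m_permutations_swap metasylvester_step_swap)

lemma mstep_coinv:
  assumes "mstep m n s t"
  shows "coinv m n s \<subset> coinv m n t"
proof -
  obtain u a c v where "s = u @ a # c # v" "t = u @ c # a # v" "a < c" "s \<in> m_permutations m n"
    using assms by (elim mstepE)
  then show ?thesis using coinv_swap[of u a c v m n] by blast
qed

lemma mstep_rtranclp_coinv: "(mstep m n)\<^sup>*\<^sup>* s t \<Longrightarrow> coinv m n s \<subseteq> coinv m n t"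
  by (induction rule: rtranclp_induct) (auto dest: mstep_coinv)

lemma wfp_mstep: "wfp (mstep m n)"
proof (rule wfp_if_convertible_to_nat)
  show "card (coinv m n s) < card (coinv m n t)" if "mstep m n s t" for s t
    using mstep_coinv[OF that] by (simp add: psubset_card_mono finite_coinv)
qed

text \<open>The number of pairs, in a finite box around all co-inversion sets, that are not yet
  co-inversions. It falls along upward steps and so measures upward inductions.\<close>

abbreviation codepth :: "nat \<Rightarrow> nat \<Rightarrow> nat list \<Rightarrow> nat" where
  "codepth m n s \<equiv> card (({0..n} \<times> {0..m}) \<times> ({0..n} \<times> {0..m}) - coinv m n s)"

lemma codepth_less: "coinv m n s \<subset> coinv m n t \<Longrightarrow> codepth m n t < codepth m n s"
  using coinv_subset[of m n t] by (intro psubset_card_mono) auto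

lemma wfp_mstep_converse: "wfp (mstep m n)\<inverse>\<inverse>"
proof (rule wfp_if_convertible_to_nat)
  show "codepth m n s < codepth m n t" if "(mstep m n)\<inverse>\<inverse> s t" for s t
    using mstep_coinv[of m n t s] that by (intro codepth_less) auto
qed

section \<open>Squares and hexagons\<close>

lemma contractible_square:
  "contractible (u @ a # c # t) a' c' v \<longleftrightarrow> contractible (u @ c # a # t) a' c' v"
  "contractible u a c (t @ a' # c' # v) \<longleftrightarrow> contractible u a c (t @ c' # a' # v)"
  by (auto simp: contractible_def)

text \<open>The third letter is never a witness: z is too large for the pair x y, and x is too small
  for the pair y z. So the side on which it stands is irrelevant.\<close>

lemma contractible_hexagon_opposite:
  assumes "x < y" "y < z"
  shows "contractible (u @ [z]) x y v \<longleftrightarrow> contractible u x y (z # v)"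
    and "contractible u y z (x # v) \<longleftrightarrow> contractible (u @ [x]) y z v"
  using assms by (auto simp: contractible_def)

text \<open>A witness b with x \<le> b < y also satisfies b < z, and it is found among the letters
  of \<open>u\<close>, the x itself and \<open>v\<close>, which keep their sides.\<close>

lemma contractible_hexagon_middle:
  assumes "x < y" "y < z"
  shows "contractible u x y (z # v) \<Longrightarrow> contractible u x z (y # v)"
    and "contractible u x y (z # v) \<Longrightarrow> contractible (u @ [y]) x z v"
  using assms by (auto simp: contractible_def)

lemma mstep_square:
  assumes "a < c" "a' < c'"
  shows "mstep m n (u @ a # c # t @ a' # c' # v) (u @ c # a # t @ a' # c' # v) \<longleftrightarrow>
      mstep m n (u @ a # c # t @ c' # a' # v) (u @ c # a # t @ c' # a' # v)"
    and "mstep m n (u @ a # c # t @ a' # c' # v) (u @ a # c # t @ c' # a' # v) \<longleftrightarrow>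
      mstep m n (u @ c # a # t @ a' # c' # v) (u @ c # a # t @ c' # a' # v)"
proof -
  show "mstep m n (u @ a # c # t @ a' # c' # v) (u @ c # a # t @ a' # c' # v) \<longleftrightarrow>
      mstep m n (u @ a # c # t @ c' # a' # v) (u @ c # a # t @ c' # a' # v)"
    using m_permutations_cong[of "u @ a # c # t @ a' # c' # v" "u @ a # c # t @ c' # a' # v" m n]
    contractible_square(2)[of u a c t a' c' v]
    by (simp add: mstep_swap[OF assms(1)])
  show "mstep m n (u @ a # c # t @ a' # c' # v) (u @ a # c # t @ c' # a' # v) \<longleftrightarrow>
      mstep m n (u @ c # a # t @ a' # c' # v) (u @ c # a # t @ c' # a' # v)"
    using m_permutations_cong[of "u @ a # c # t @ a' # c' # v" "u @ c # a # t @ a' # c' # v" m n]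
      mstep_swap[OF assms(2), of m n "u @ a # c # t" v]
      mstep_swap[OF assms(2), of m n "u @ c # a # t" v]
      contractible_square[of u a c t a' c' v]
    by simp
qed

text \<open>The hexagon rises from xyz to zyx, on one side through yxz and yzx, on the other through
  xzy and zxy. All six words have the same letters, so contractibility alone decides which edges are
  steps.\<close>

lemma mstep_hexagon:
  assumes "x < y" "y < z"
  shows "mstep m n (u @ x # y # z # v) (u @ y # x # z # v) \<longleftrightarrow>
      mstep m n (u @ z # x # y # v) (u @ z # y # x # v)"
    and "mstep m n (u @ x # y # z # v) (u @ x # z # y # v) \<longleftrightarrow>
      mstep m n (u @ y # z # x # v) (u @ z # y # x # v)"
    and "mstep m n (u @ x # y # z # v) (u @ y # x # z # v) \<Longrightarrow>
      mstep m n (u @ x # z # y # v) (u @ z # x # y # v)"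
    and "mstep m n (u @ x # y # z # v) (u @ y # x # z # v) \<Longrightarrow>
      mstep m n (u @ y # x # z # v) (u @ y # z # x # v)"
proof -
  let ?s = "u @ x # y # z # v"
  have M: "u @ z # x # y # v \<in> m_permutations m n \<longleftrightarrow> ?s \<in> m_permutations m n"
    "u @ y # z # x # v \<in> m_permutations m n \<longleftrightarrow> ?s \<in> m_permutations m n"
    "u @ x # z # y # v \<in> m_permutations m n \<longleftrightarrow> ?s \<in> m_permutations m n"
    "u @ y # x # z # v \<in> m_permutations m n \<longleftrightarrow> ?s \<in> m_permutations m n"
    by (rule m_permutations_cong; simp)+
  have "x < z" using assms by simp
  note swaps = mstep_swap[OF assms(1), of m n u "z # v"] mstep_swap[OF assms(1), of m n "u @ [z]" v]
    mstep_swap[OF assms(2), of m n "u @ [x]" v] mstep_swap[OF assms(2), of m n u "x # v"]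
    mstep_swap[OF \<open>x < z\<close>, of m n u "y # v"] mstep_swap[OF \<open>x < z\<close>, of m n "u @ [y]" v]
  show "mstep m n ?s (u @ y # x # z # v) \<longleftrightarrow> mstep m n (u @ z # x # y # v) (u @ z # y # x # v)"
    using swaps M contractible_hexagon_opposite(1)[OF assms, of u v] by simp
  show "mstep m n ?s (u @ x # z # y # v) \<longleftrightarrow> mstep m n (u @ y # z # x # v) (u @ z # y # x # v)"
    using swaps M contractible_hexagon_opposite(2)[OF assms, of u v] by simp
  show "mstep m n ?s (u @ y # x # z # v) \<Longrightarrow>
      mstep m n (u @ x # z # y # v) (u @ z # x # y # v)"
    using swaps M contractible_hexagon_middle(1)[OF assms, of u v] by simp
  show "mstep m n ?s (u @ y # x # z # v) \<Longrightarrow>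
      mstep m n (u @ y # x # z # v) (u @ y # z # x # v)"
    using swaps M contractible_hexagon_middle(2)[OF assms, of u v] by simp
qed

text \<open>The two switches add independent pairs, so the top of the square lies below every word
  that is above both middle corners.\<close>

lemma coinv_square:
  assumes "u @ a # c # t @ a' # c' # v \<in> m_permutations m n" "a < c" "a' < c'"
  shows "coinv m n (u @ c # a # t @ c' # a' # v) =
    coinv m n (u @ c # a # t @ a' # c' # v) \<union> coinv m n (u @ a # c # t @ c' # a' # v)"
proof -
  have "u @ a # c # t @ c' # a' # v \<in> m_permutations m n"
    using assms(1) m_permutations_swap[of "u @ a # c # t" c' a' v] by simp
  then show ?thesis
    using coinv_swap(1)[of u a c "t @ c' # a' # v" m n] coinv_swap(1)[of u a c "t @ a' # c' # v" m n]
      coinv_swap(1)[of "u @ a # c # t" a' c' v m n] assms by auto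
qed

text \<open>As x, y, z are distinct, passing one of them does not shift the indices of the other
  two. Each edge therefore adds one of three pairs computed from \<open>u\<close> alone.\<close>

lemma coinv_hexagon:
  assumes "u @ x # y # z # v \<in> m_permutations m n" (is "?s \<in> ?M") "x < y" "y < z"
  shows "coinv m n (u @ y # x # z # v) = insert (swap_pair u x y) (coinv m n ?s)"
    and "coinv m n (u @ x # z # y # v) = insert (swap_pair u y z) (coinv m n ?s)"
    and "coinv m n (u @ y # z # x # v) =
      insert (swap_pair u x z) (insert (swap_pair u x y) (coinv m n ?s))"
    and "coinv m n (u @ z # x # y # v) =
      insert (swap_pair u x z) (insert (swap_pair u y z) (coinv m n ?s))"
    and "coinv m n (u @ z # y # x # v) =
      {swap_pair u x y, swap_pair u y z, swap_pair u x z} \<union> coinv m n ?s"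
proof -
  have M: "u @ z # x # y # v \<in> ?M" "u @ y # z # x # v \<in> ?M" "u @ x # z # y # v \<in> ?M"
    "u @ y # x # z # v \<in> ?M"
    using assms(1) by (rule m_permutations_cong[THEN iffD1, rotated]; simp)+
  show xy: "coinv m n (u @ y # x # z # v) = insert (swap_pair u x y) (coinv m n ?s)"
    using coinv_swap(1)[of u x y "z # v"] assms by simp
  show yz: "coinv m n (u @ x # z # y # v) = insert (swap_pair u y z) (coinv m n ?s)"
    using coinv_swap(1)[of "u @ [x]" y z v] assms by simp
  show "coinv m n (u @ y # z # x # v) =
      insert (swap_pair u x z) (insert (swap_pair u x y) (coinv m n ?s))"
    using coinv_swap(1)[of "u @ [y]" x z v] assms M xy by simp
  show zxy: "coinv m n (u @ z # x # y # v) =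
      insert (swap_pair u x z) (insert (swap_pair u y z) (coinv m n ?s))"
    using coinv_swap(1)[of u x z "y # v"] assms M yz by simp
  show "coinv m n (u @ z # y # x # v) =
      {swap_pair u x y, swap_pair u y z, swap_pair u x z} \<union> coinv m n ?s"
    using coinv_swap(1)[of "u @ [z]" x y v] assms M zxy by auto
qed

section \<open>Local confluence upwards and downwards\<close>

lemma mstep_locally_confluent:
  assumes "mstep m n s t" "mstep m n s t'"
  shows "\<exists>r. (mstep m n)\<^sup>*\<^sup>* t r \<and> (mstep m n)\<^sup>*\<^sup>* t' r"
proof -
  have *: "\<exists>r. (mstep m n)\<^sup>*\<^sup>* t r \<and> (mstep m n)\<^sup>*\<^sup>* t' r"
    if st: "s = u @ a # c # v" "t = u @ c # a # v" "a < c" "mstep m n s t"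
    and st': "s = u' @ a' # c' # v'" "t' = u' @ c' # a' # v'" "a' < c'" "mstep m n s t'"
    and len: "length u \<le> length u'" for t t' u a c v u' a' c' v'
  proof -
    have "u @ a # c # v = u' @ a' # c' # v'" using st(1) st'(1) by simp
    from this len show ?thesis
    proof (cases rule: adjacent_pairs_cases)
      case same
      then show ?thesis using st st' by auto
    next
      case eqs: overlap
      have "c < c'" using eqs st'(3) by simp
      note hex = mstep_hexagon[OF \<open>a < c\<close> this, of m n u v']
      \<comment> \<open>Both bottom edges are steps. The one on the two smallest letters forces the
        middle edges, and the top edges are opposite to the bottom ones.\<close>
      have "mstep m n t (u @ c # c' # a # v')" "mstep m n (u @ c # c' # a # v') (u @ c' # c # a # v')"
        "mstep m n t' (u @ c' # a # c # v')" "mstep m n (u @ c' # a # c # v') (u @ c' # c # a # v')"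
        using hex st st' eqs by simp_all
      then show ?thesis by (meson converse_rtranclp_into_rtranclp r_into_rtranclp)
    next
      case (disjoint r)
      then have "mstep m n t (u @ c # a # r @ c' # a' # v')" "mstep m n t' (u @ c # a # r @ c' # a' # v')"
        using mstep_square[OF \<open>a < c\<close> \<open>a' < c'\<close>, of m n u r v'] st st' by simp_all
      then show ?thesis by blast
    qed
  qed
  \<comment> \<open>The claim is symmetric in \<open>t\<close> and \<open>t'\<close>, so the pair
    further left may be taken first.\<close>
  from assms show ?thesis
    by (elim mstepE) (metis * assms linorder_le_cases)
qed

lemma mstep_locally_confluent_converse:
  assumes "mstep m n t s" "mstep m n t' s"
  shows "\<exists>r. (mstep m n)\<^sup>*\<^sup>* r t \<and> (mstep m n)\<^sup>*\<^sup>* r t'"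
proof -
  have *: "\<exists>r. (mstep m n)\<^sup>*\<^sup>* r t \<and> (mstep m n)\<^sup>*\<^sup>* r t'"
    if st: "s = u @ c # a # v" "t = u @ a # c # v" "a < c" "mstep m n t s"
    and st': "s = u' @ c' # a' # v'" "t' = u' @ a' # c' # v'" "a' < c'" "mstep m n t' s"
    and len: "length u \<le> length u'" for t t' u a c v u' a' c' v'
  proof -
    have "u @ c # a # v = u' @ c' # a' # v'" using st(1) st'(1) by simp
    from this len show ?thesis
    proof (cases rule: adjacent_pairs_cases)
      case same
      then show ?thesis using st st' by auto
    next
      case eqs: overlap
      have "a' < a" using eqs st'(3) by simp
      note hex = mstep_hexagon[OF this \<open>a < c\<close>, of m n u v']
      \<comment> \<open>Here the top edges are given. Their opposites are the bottom edges, which in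
        turn force the middle ones.\<close>
      have "mstep m n (u @ a' # a # c # v') (u @ a # a' # c # v')" "mstep m n (u @ a # a' # c # v') t"
        "mstep m n (u @ a' # a # c # v') (u @ a' # c # a # v')" "mstep m n (u @ a' # c # a # v') t'"
        using hex st st' eqs by simp_all
      then show ?thesis by (meson converse_rtranclp_into_rtranclp r_into_rtranclp)
    next
      case (disjoint r)
      then have "mstep m n (u @ a # c # r @ a' # c' # v') t" "mstep m n (u @ a # c # r @ a' # c' # v') t'"
        using mstep_square[OF \<open>a < c\<close> \<open>a' < c'\<close>, of m n u r v'] st st' by simp_all
      then show ?thesis by blast
    qed
  qed
  from assms show ?thesis
    by (elim mstepE) (metis * assms linorder_le_cases)
qed

section \<open>Convexity of the classes\<close>

text \<open>Let \<open>s1\<close> be the first word on the path from \<open>s\<close> to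
  \<open>y\<close>. The polygon spanned by \<open>s1\<close> and the switched word has its top below
  \<open>y\<close>. The induction hypothesis climbs from \<open>s1\<close> to that top and on to
  \<open>y\<close>; the polygon relations then make the other side contractible too.\<close>

lemma ascent_contractible_below:
  assumes y: "y \<in> m_permutations m n"
    and "(mstep m n)\<^sup>*\<^sup>* s y" "s = u' @ a' # c' # v'" "s \<in> m_permutations m n" "a' < c'"
    and "coinv m n (u' @ c' # a' # v') \<subseteq> coinv m n y"
  shows "mstep m n s (u' @ c' # a' # v') \<and> (mstep m n)\<^sup>*\<^sup>* (u' @ c' # a' # v') y"
  using assms(2-6)
proof (induction "codepth m n s" arbitrary: s u' a' c' v' rule: less_induct)
  case less
  let ?s' = "u' @ c' # a' # v'"
  note sM = less.prems(3)
  have strict: "coinv m n s \<subset> coinv m n ?s'"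
    using coinv_swap[of u' a' c' v' m n] less.prems by auto
  have "s \<noteq> y" using strict less.prems(5) by auto
  then obtain s1 where s1: "mstep m n s s1" "(mstep m n)\<^sup>*\<^sup>* s1 y"
    using less.prems(1) by (metis converse_rtranclpE)
  have s1y: "coinv m n s1 \<subseteq> coinv m n y" using mstep_rtranclp_coinv[OF s1(2)] .
  obtain u a c v where s: "s = u @ a # c # v" and s1_eq: "s1 = u @ c # a # v" and "a < c"
    using s1(1) by (elim mstepE)
  have s1M: "s1 \<in> m_permutations m n" using s1(1) by (simp add: mstep_def)
  have IH: "mstep m n (w @ i # k # x) (w @ k # i # x) \<and> (mstep m n)\<^sup>*\<^sup>* (w @ k # i # x) y"
    if "(mstep m n)\<^sup>*\<^sup>* s1 (w @ i # k # x)" "(mstep m n)\<^sup>*\<^sup>* (w @ i # k # x) y" "i < k"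
      "coinv m n (w @ k # i # x) \<subseteq> coinv m n y" for w i k x
  proof -
    have "coinv m n s \<subset> coinv m n (w @ i # k # x)"
      using mstep_coinv[OF s1(1)] mstep_rtranclp_coinv[OF that(1)] by blast
    moreover have "w @ i # k # x \<in> m_permutations m n"
      using that(1) s1M by (cases rule: rtranclp.cases) (auto simp: mstep_def)
    ultimately show ?thesis using less.hyps[OF codepth_less] that(2-4) by blast
  qed
  have hexagon: ?case
    if eq: "s = w @ i # j # k # x" "s1 = w @ j # i # k # x \<and> ?s' = w @ i # k # j # x \<or>
        s1 = w @ i # k # j # x \<and> ?s' = w @ j # i # k # x" and "i < j" "j < k" for w i j k x
  proof -
    note coinvs = coinv_hexagon[OF sM[unfolded eq(1)] \<open>i < j\<close> \<open>j < k\<close>]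
    note hex = mstep_hexagon[OF \<open>i < j\<close> \<open>j < k\<close>, of m n w x]
    have "i < k" using \<open>i < j\<close> \<open>j < k\<close> by simp
    have "swap_pair w i j \<in> coinv m n y" "swap_pair w j k \<in> coinv m n y"
      using eq(2) s1y less.prems(5) coinvs(1,2) by auto
    \<comment> \<open>Transitivity supplies the third pair, which neither neighbour of
      \<open>s\<close> provides; with it the whole hexagon lies below \<open>y\<close>.\<close>
    moreover from this have "swap_pair w i k \<in> coinv m n y" by (rule coinv_trans[OF y])
    moreover have "coinv m n s \<subseteq> coinv m n y" using strict less.prems(5) by blast
    ultimately have le: "coinv m n (w @ j # k # i # x) \<subseteq> coinv m n y"
      "coinv m n (w @ k # i # j # x) \<subseteq> coinv m n y" "coinv m n (w @ k # j # i # x) \<subseteq> coinv m n y"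
      unfolding coinvs eq(1) by auto
    from eq(2) show ?case
    proof (elim disjE conjE)
      assume s1_eq: "s1 = w @ j # i # k # x" and s'_eq: "?s' = w @ i # k # j # x"
      have 1: "mstep m n s1 (w @ j # k # i # x)" "(mstep m n)\<^sup>*\<^sup>* (w @ j # k # i # x) y"
        using IH[of "w @ [j]" i k x] s1(2) \<open>i < k\<close> le(1) s1_eq by simp_all
      have 2: "mstep m n (w @ j # k # i # x) (w @ k # j # i # x)"
        "(mstep m n)\<^sup>*\<^sup>* (w @ k # j # i # x) y"
        using IH[of w j k "i # x"] 1 \<open>j < k\<close> le(3) by auto
      \<comment> \<open>The step to \<open>s1\<close> on the two smallest letters forces the middle
        edge and is opposite to the top edge; the edge to \<open>?s'\<close> is opposite to the top
        edge just climbed.\<close>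
      have "mstep m n ?s' (w @ k # i # j # x)" "mstep m n (w @ k # i # j # x) (w @ k # j # i # x)"
        "mstep m n s ?s'"
        using hex s1(1) 2(1) unfolding eq(1) s1_eq s'_eq by simp_all
      then show ?case using 2(2) by (metis converse_rtranclp_into_rtranclp)
    next
      assume s1_eq: "s1 = w @ i # k # j # x" and s'_eq: "?s' = w @ j # i # k # x"
      have 1: "mstep m n s1 (w @ k # i # j # x)" "(mstep m n)\<^sup>*\<^sup>* (w @ k # i # j # x) y"
        using IH[of w i k "j # x"] s1(2) \<open>i < k\<close> le(2) s1_eq by simp_all
      have 2: "mstep m n (w @ k # i # j # x) (w @ k # j # i # x)"
        "(mstep m n)\<^sup>*\<^sup>* (w @ k # j # i # x) y"
        using IH[of "w @ [k]" i j x] 1 \<open>i < j\<close> le(3) by auto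
      \<comment> \<open>The order is reversed: the top edge just climbed yields the opposite edge to
        \<open>?s'\<close>, and this one, on the two smallest letters, forces the middle
        edge.\<close>
      have "mstep m n s ?s'" "mstep m n ?s' (w @ j # k # i # x)"
        "mstep m n (w @ j # k # i # x) (w @ k # j # i # x)"
        using hex s1(1) 2(1) unfolding eq(1) s1_eq s'_eq by simp_all
      then show ?case using 2(2) by (metis converse_rtranclp_into_rtranclp)
    qed
  qed
  show ?case
  proof (cases "length u \<le> length u'")
    case True
    have "u @ a # c # v = u' @ a' # c' # v'" using s less.prems(2) by simp
    from this True show ?thesis
    proof (cases rule: adjacent_pairs_cases)
      case same
      then show ?thesis using s1 s1_eq by simp
    next
      case overlap
      then show ?thesis using hexagon[of u a c c' v'] s s1_eq \<open>a < c\<close> less.prems(4) by simp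
    next
      case t: (disjoint t)
      let ?r = "u @ c # a # t @ c' # a' # v'"
      have "coinv m n ?r \<subseteq> coinv m n y"
        using coinv_square[of u a c t a' c' v' m n] sM s t \<open>a < c\<close> less.prems(4,5) s1y s1_eq by simp
      then have "mstep m n s1 ?r \<and> (mstep m n)\<^sup>*\<^sup>* ?r y"
        using IH[of "u @ c # a # t" a' c' v'] s1 s1_eq t less.prems(4) by simp
      moreover from this have "mstep m n s ?s'" "mstep m n ?s' ?r"
        using mstep_square[OF \<open>a < c\<close> \<open>a' < c'\<close>, of m n u t v'] s1(1) s1_eq s t by simp_all
      ultimately show ?thesis by (metis converse_rtranclp_into_rtranclp)
    qed
  next
    case False
    have "u' @ a' # c' # v' = u @ a # c # v" using s less.prems(2) by simp
    moreover have "length u' \<le> length u" using False by simp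
    ultimately show ?thesis
    proof (cases rule: adjacent_pairs_cases)
      case same
      then show ?thesis using s1 s1_eq by simp
    next
      case overlap
      then show ?thesis using hexagon[of u' a' c' c v] s s1_eq \<open>a < c\<close> less.prems(4) by simp
    next
      case t: (disjoint t)
      let ?r = "u' @ c' # a' # t @ c # a # v"
      have "coinv m n ?r \<subseteq> coinv m n y"
        using coinv_square[of u' a' c' t a c v m n] sM s t \<open>a < c\<close> less.prems(4,5) s1y s1_eq by simp
      then have "mstep m n s1 ?r \<and> (mstep m n)\<^sup>*\<^sup>* ?r y"
        using IH[of u' a' c' "t @ c # a # v"] s1 s1_eq t less.prems(4) by simp
      moreover from this have "mstep m n s ?s'" "mstep m n ?s' ?r"
        using mstep_square[OF \<open>a' < c'\<close> \<open>a < c\<close>, of m n u' t v] s1(1) s1_eq s t by simp_all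
      ultimately show ?thesis by (metis converse_rtranclp_into_rtranclp)
    qed
  qed
qed

text \<open>The invariant of the climb is that the current word reaches \<open>y\<close>. An ascent
  chosen to stay below \<open>z\<close> also stays below \<open>y\<close>, so its switch is
  contractible and preserves the invariant.\<close>

lemma mstep_convex:
  assumes y: "y \<in> m_permutations m n" and z: "z \<in> m_permutations m n"
    and "(mstep m n)\<^sup>*\<^sup>* s y" "s \<in> m_permutations m n"
    and "coinv m n s \<subseteq> coinv m n z" "coinv m n z \<subseteq> coinv m n y"
  shows "(mstep m n)\<^sup>*\<^sup>* s z"
  using assms(3-6)
proof (induction "codepth m n s" arbitrary: s rule: less_induct)
  case less
  show ?case
  proof (cases "s = z")
    case False
    obtain u a c v where s: "s = u @ a # c # v" "a < c" "swap_pair u a c \<in> coinv m n z"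
      using exists_ascent_below[OF less.prems(2) z less.prems(3) False] by blast
    let ?t = "u @ c # a # v"
    have le: "coinv m n ?t \<subseteq> coinv m n z"
      using coinv_swap(1)[of u a c v m n] s less.prems by auto
    then have step: "mstep m n s ?t" "(mstep m n)\<^sup>*\<^sup>* ?t y"
      using ascent_contractible_below[OF y less.prems(1) s(1) less.prems(2) s(2)] less.prems(4)
      by auto
    have "?t \<in> m_permutations m n" using step(1) by (simp add: mstep_def)
    then have "(mstep m n)\<^sup>*\<^sup>* ?t z"
      using less.hyps[of ?t] codepth_less[OF mstep_coinv[OF step(1)]] step(2) le less.prems(4)
      by blast
    then show ?thesis using step(1) by (rule converse_rtranclp_into_rtranclp[rotated])
  qed simp
qed

section \<open>Least and greatest words of a class\<close>

theorem proposition3p7: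
  fixes m n :: nat and C :: "nat list set"
  assumes "m \<ge> 1" and "n \<ge> 1"
    and "C \<in> m_permutations m n // metasylvester m n"
  shows "poset_interval (m_permutations m n) (mperm_le m n) C"
proof -
  let ?M = "m_permutations m n" and ?R = "mstep m n"
  obtain s where s: "s \<in> ?M" and C: "C = metasylvester m n `` {s}"
    using assms(3) by (rule quotientE)
  have mem: "t \<in> C \<longleftrightarrow> t \<in> ?M \<and> equivclp ?R s t" for t
    using s unfolding C metasylvester_def mstep_def by auto
  obtain y where y: "\<And>t. equivclp ?R s t \<Longrightarrow> ?R\<^sup>*\<^sup>* t y"
    using newman_equivclp[of ?R s, OF wfp_mstep_converse] mstep_locally_confluent by blast
  \<comment> \<open>The reversed relation generates the same equivalence, and its normal form is the
    least word.\<close>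
  have "\<exists>x. \<forall>t. equivclp ?R\<inverse>\<inverse> s t \<longrightarrow> ?R\<inverse>\<inverse>\<^sup>*\<^sup>* t x"
  proof (rule newman_equivclp)
    show "wfp (?R\<inverse>\<inverse>)\<inverse>\<inverse>" using wfp_mstep by simp
    show "\<exists>r. ?R\<inverse>\<inverse>\<^sup>*\<^sup>* t r \<and> ?R\<inverse>\<inverse>\<^sup>*\<^sup>* t' r" if "?R\<inverse>\<inverse> p t" "?R\<inverse>\<inverse> p t'" for p t t'
      using mstep_locally_confluent_converse that by (simp add: rtranclp_conversep)
  qed
  then obtain x where x: "\<And>t. equivclp ?R s t \<Longrightarrow> ?R\<^sup>*\<^sup>* x t"
    by (auto simp: rtranclp_conversep)
  have sy: "?R\<^sup>*\<^sup>* s y" and xs: "?R\<^sup>*\<^sup>* x s" using x y by (simp_all add: equivclp_refl)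
  have xM: "x \<in> ?M" using xs s by (cases rule: converse_rtranclpE) (auto simp: mstep_def)
  have yM: "y \<in> ?M" using sy s by (cases rule: rtranclp.cases) (auto simp: mstep_def)
  have xy: "?R\<^sup>*\<^sup>* x y" using xs sy by simp
  have "C = {z \<in> ?M. mperm_le m n x z \<and> mperm_le m n z y}"
  proof (intro equalityI subsetI)
    fix z assume "z \<in> C"
    then show "z \<in> {z \<in> ?M. mperm_le m n x z \<and> mperm_le m n z y}"
      using x y by (auto simp: mem mperm_le_def dest: mstep_rtranclp_coinv)
  next
    fix z assume z: "z \<in> {z \<in> ?M. mperm_le m n x z \<and> mperm_le m n z y}"
    then have "?R\<^sup>*\<^sup>* x z" using mstep_convex[OF yM _ xy xM] by (simp add: mperm_le_def)
    then have "equivclp ?R s z"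
      using xs by (meson equivclp_sym equivclp_trans predicate2D rtranlcp_le_equivclp)
    then show "z \<in> C" using z by (simp add: mem)
  qed
  moreover have "mperm_le m n x y" using mstep_rtranclp_coinv[OF xy] by (simp add: mperm_le_def)
  ultimately show ?thesis using xM yM unfolding poset_interval_def by blast
qed

end
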